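(* Let $L$ be a transverse link that is the negative stabilization of another transverse link. Then $\psi(L)=0$ in $Kh'(L)$.
   Context: Odd Khovanov complex. $R$ is the coefficient ring ($\mathbb Z$ or a field). Let $D$ be an oriented link diagram with crossing set $\mathcal X$. Each crossing has a 0- and a 1-smoothing (standard Khovanov convention: the orientation-respecting smoothing is the 0-smoothing at a positive crossing and the 1-smoothing at a negative crossing). For $\alpha:\mathcal X\to\{0,1\}$, smoothing each $x$ by its $\alpha(x)$-smoothing gives disjoint planar circles $a_1,\dots,a_k$; put $V_\alpha=R\langle v_1,\dots,v_k\rangle$ ($v_i$ corresponds to $a_i$). Choose at each crossing an arrow joining the two arcs of its 0-smoothing; rotating it $90^\circ$ clockwise gives an arrow joining the two arcs of the 1-smoothing. For an edge $e:\alpha_0\to\alpha_1$ of the cube (one value changes from 0 to 1) define $F_e:\Lambda^*V_{\alpha_0}\to\Lambda^*V_{\alpha_1}$: if two circles merge, $F_e$ is the algebra map identifying their generators; if a circle $a$ splits into $a_0,a_1$, with the arrow in the 1-smoothing pointing from $a_0$ to $a_1$, then $F_e(\omega)=(v_0-v_1)\wedge\omega$, where in $\omega$ the generator of $a$ is replaced by $v_0$ (equivalently $v_1$). A 2-dimensional face of the cube is of type A (resp. C) if, over $\mathbb Z$, its two compositions of maps $F_e$ are nonzero and anticommute (resp. commute). In the remaining faces both compositions vanish; there the initial resolution has one circle carrying one arrow inside and one arrow outside with interleaved endpoints; going counterclockwise from the tail of the inner arrow, the face is of type X if the next endpoint is the tail of the outer arrow and of type Y if it is its head. A sign assignment is $\varepsilon$: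 edges $\to\{\pm1\}$ such that each face of type A or X has an even number, and each face of type C or Y an odd number, of edges with $\varepsilon=-1$. $C(D)=\bigoplus_\alpha\Lambda^*V_\alpha$ with differential $d=\sum_e\varepsilon(e)F_e$; up to isomorphism it does not depend on the choices. Its homology is the odd Khovanov homology $Kh'(L)$ of the link $L$ of $D$. Transverse links. Transverse links (in the standard contact $\mathbb R^3$) are represented by braid diagrams, i.e. closures of braid words; two braid diagrams represent the same transverse link iff they are related by finitely many braid group relations, conjugations, and positive stabilizations/destabilizations ($B\in B_b\leftrightarrow B\sigma_b\in B_{b+1}$). If a transverse link is represented by the closure of $B\in B_b$, its negative stabilization is the transverse link represented by the closure of $B\sigma_b^{-1}\in B_{b+1}$. The class $\psi$. For a braid diagram $D$ on $b$ strands of a transverse link $L$ let $\alpha'$ be the resolution with the 0-smoothing at every positive and the 1-smoothing at every negative crossing, so that the resolution consists of $b$ parallel circles. Set $\psi(D)=v_1\wedge\cdots\wedge v_b\in\Lambda^bV_{\alpha'}\subset C(D)$. It is a cycle; its class in $Kh'(L)$ is well defined up to sign and, up to isomorphism of $Kh'$, independent of the braid diagram of $L$; it is denoted $\psi(L)$. *)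

theory Defs
  imports "HOL-Algebra.Coset" "HOL-Library.Product_Lexorder"
begin

section \<open>Coefficients\<close>

definition coefficient_ring :: "'r::comm_ring_1 itself \<Rightarrow> bool" where
  "coefficient_ring _ \<longleftrightarrow>
     bij (of_int :: int \<Rightarrow> 'r) \<or> (\<forall>x::'r. x \<noteq> 0 \<longrightarrow> (\<exists>y. x * y = 1))"

text \<open>The first alternative says that the ring is (isomorphic to) the integers, the second that
  it is a field.\<close>


section \<open>The exterior algebra on a finite set of generators\<close>

text \<open>An element of the exterior algebra of the free module on a finite set \<open>G\<close> of linearly ordered
  generators is given by its coordinates with respect to the basis consisting of the
  \<open>g\<^sub>1 \<and> \<dots> \<and> g\<^sub>k\<close> with \<open>g\<^sub>1 < \<dots> < g\<^sub>k\<close> in \<open>G\<close>; that basis element is indexed by the set of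
  its factors.\<close>

type_synonym ('g, 'r) ext = "'g set \<Rightarrow> 'r"

definition ext_algebra :: "'g set \<Rightarrow> ('g, 'r::comm_ring_1) ext set" where
  "ext_algebra G = {\<omega>. \<forall>S. \<omega> S \<noteq> 0 \<longrightarrow> S \<subseteq> G}"

definition ext_one :: "('g, 'r::comm_ring_1) ext" where
  "ext_one = (\<lambda>S. if S = {} then 1 else 0)"

definition gen :: "'g \<Rightarrow> ('g, 'r::comm_ring_1) ext" where
  "gen g = (\<lambda>S. if S = {g} then 1 else 0)"

text \<open>The sign is that of the permutation sorting the increasing list of \<open>T\<close> followed by the
  increasing list of \<open>S - T\<close>.\<close>

definition wedge :: "('g::linorder, 'r::comm_ring_1) ext \<Rightarrow> ('g, 'r) ext \<Rightarrow> ('g, 'r) ext" where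
  "wedge \<omega> \<eta> = (\<lambda>S. \<Sum>T\<in>Pow S.
     (- 1) ^ card {(t, u). t \<in> T \<and> u \<in> S - T \<and> u < t} * \<omega> T * \<eta> (S - T))"

definition wedge_gens :: "'g list \<Rightarrow> ('g::linorder, 'r::comm_ring_1) ext" where
  "wedge_gens gs = foldr (\<lambda>g. wedge (gen g)) gs ext_one"

text \<open>The algebra map out of the exterior algebra on \<open>G\<close> that sends the generator \<open>g\<close> to the
  generator \<open>\<phi> g\<close>.\<close>

definition ext_map ::
  "'g set \<Rightarrow> ('g \<Rightarrow> 'h) \<Rightarrow> ('g::linorder, 'r::comm_ring_1) ext \<Rightarrow> ('h::linorder, 'r) ext" where
  "ext_map G \<phi> \<omega> = (\<lambda>U. \<Sum>S\<in>Pow G. \<omega> S * wedge_gens (map \<phi> (sorted_list_of_set S)) U)"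


section \<open>Braid words and transverse links\<close>

text \<open>The letter \<open>(i, True)\<close> is \<open>\<sigma>\<^sub>i\<close> and \<open>(i, False)\<close> is its inverse; \<open>(b, w)\<close> is the word
  \<open>w\<close> on \<open>b\<close> strands, and it also stands for the diagram that is the closure of \<open>w\<close>.\<close>

type_synonym braid = "nat \<times> (nat \<times> bool) list"

definition braid_words :: "braid set" where
  "braid_words = {(b, w). 1 \<le> b \<and> (\<forall>(i, s)\<in>set w. 1 \<le> i \<and> i < b)}"

inductive braid_move :: "braid \<Rightarrow> braid \<Rightarrow> bool" where
  cancel: "braid_move (b, u @ [(i, s), (i, \<not> s)] @ v) (b, u @ v)"
| far: "i + 1 < j \<Longrightarrow>
    braid_move (b, u @ [(i, True), (j, True)] @ v) (b, u @ [(j, True), (i, True)] @ v)"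
| braid: "braid_move (b, u @ [(i, True), (i + 1, True), (i, True)] @ v)
    (b, u @ [(i + 1, True), (i, True), (i + 1, True)] @ v)"
| conjugation: "braid_move (b, [(i, s)] @ w @ [(i, \<not> s)]) (b, w)"
| stabilization: "braid_move (b, w) (b + 1, w @ [(b, True)])"

definition transverse_rel :: "(braid \<times> braid) set" where
  "transverse_rel = {(D, D'). D \<in> braid_words \<and> D' \<in> braid_words \<and>
     equivclp (\<lambda>E E'. E \<in> braid_words \<and> E' \<in> braid_words \<and> braid_move E E') D D'}"

text \<open>A transverse link is identified with the set of all braid diagrams representing it.\<close>

definition transverse_links :: "braid set set" where
  "transverse_links = braid_words // transverse_rel"

definition neg_stab :: "braid \<Rightarrow> braid" where
  "neg_stab D = (fst D + 1, snd D @ [(fst D, False)])"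

definition is_neg_stab_of :: "braid set \<Rightarrow> braid set \<Rightarrow> bool" where
  "is_neg_stab_of L L0 \<longleftrightarrow> L \<in> transverse_links \<and> L0 \<in> transverse_links \<and>
     (\<exists>D\<in>L0. neg_stab D \<in> L)"


section \<open>Smoothings of a braid closure\<close>

text \<open>The braid is drawn upwards, strand positions are numbered \<open>1, \<dots>, b\<close> from left to right and the
  crossings \<open>0, \<dots>, n - 1\<close> from bottom to top. The point \<open>(k, j)\<close> lies at position \<open>k\<close> just below
  crossing \<open>j\<close>, for \<open>j = n\<close> above all crossings; the closure joins \<open>(k, n)\<close> to \<open>(k, 0)\<close>. Hence
  crossing \<open>c\<close> with letter \<open>\<sigma>\<^sub>i\<close> or its inverse has the corners \<open>(i, c)\<close> (south-west), \<open>(i + 1, c)\<close>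
  (south-east), \<open>(i, c + 1)\<close> (north-west) and \<open>(i + 1, c + 1)\<close> (north-east).

  A map from the crossings to \<open>{0, 1}\<close> is encoded by the set \<open>\<alpha>\<close> of crossings mapped to \<open>1\<close>.\<close>

type_synonym point = "nat \<times> nat"

abbreviation ncr :: "braid \<Rightarrow> nat" where "ncr D \<equiv> length (snd D)"
abbreviation strand :: "braid \<Rightarrow> nat \<Rightarrow> nat" where "strand D c \<equiv> fst (snd D ! c)"
abbreviation positive :: "braid \<Rightarrow> nat \<Rightarrow> bool" where "positive D c \<equiv> snd (snd D ! c)"

definition points :: "braid \<Rightarrow> point set" where
  "points D = {1..fst D} \<times> {0..ncr D}"

text \<open>Whether \<open>\<alpha>\<close> smooths \<open>c\<close> into two vertical arcs, i.e. respecting the orientation; otherwise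
  into two horizontal arcs, one joining the southern corners, one joining the northern corners.\<close>

definition vertical :: "braid \<Rightarrow> nat set \<Rightarrow> nat \<Rightarrow> bool" where
  "vertical D \<alpha> c \<longleftrightarrow> (if positive D c then c \<notin> \<alpha> else c \<in> \<alpha>)"

datatype heading = Up | Down

text \<open>Walking along a resolution: at the given point and heading, the next point and heading.\<close>

fun walk :: "braid \<Rightarrow> nat set \<Rightarrow> point \<times> heading \<Rightarrow> point \<times> heading" where
  "walk D \<alpha> ((k, j), Up) =
     (if j = ncr D then ((k, 0), Up)
      else if (k = strand D j \<or> k = strand D j + 1) \<and> \<not> vertical D \<alpha> j
      then ((2 * strand D j + 1 - k, j), Down)
      else ((k, j + 1), Up))"
| "walk D \<alpha> ((k, j), Down) =
     (if j = 0 then ((k, ncr D), Down)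
      else if (k = strand D (j - 1) \<or> k = strand D (j - 1) + 1) \<and> \<not> vertical D \<alpha> (j - 1)
      then ((2 * strand D (j - 1) + 1 - k, j), Up)
      else ((k, j - 1), Down))"

definition joined :: "braid \<Rightarrow> nat set \<Rightarrow> point \<Rightarrow> point \<Rightarrow> bool" where
  "joined D \<alpha> p q \<longleftrightarrow> p \<in> points D \<and> q \<in> points D \<and> (\<exists>h h'. walk D \<alpha> (p, h) = (q, h'))"

text \<open>The circles of a resolution are the connected components of the points; each is named by
  its least point.\<close>

definition circle_of :: "braid \<Rightarrow> nat set \<Rightarrow> point \<Rightarrow> point" where
  "circle_of D \<alpha> p = Min {q \<in> points D. equivclp (joined D \<alpha>) p q}"

definition circles :: "braid \<Rightarrow> nat set \<Rightarrow> point set" where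
  "circles D \<alpha> = circle_of D \<alpha> ` points D"


section \<open>Arrows\<close>

text \<open>A compass direction is used both for the direction of an arrow and for the arc lying on that
  side of a crossing: an arrow pointing east joins the western to the eastern vertical arc, etc.\<close>

datatype compass = North | East | South | West

fun clockwise :: "compass \<Rightarrow> compass" where
  "clockwise North = East" | "clockwise East = South"
| "clockwise South = West" | "clockwise West = North"

definition opposite :: "compass \<Rightarrow> compass" where
  "opposite d = clockwise (clockwise d)"

text \<open>\<open>arr c\<close> is the direction of the arrow at \<open>c\<close> in the 0-smoothing.\<close>

definition arrow_choice :: "braid \<Rightarrow> (nat \<Rightarrow> compass) \<Rightarrow> bool" where
  "arrow_choice D arr \<longleftrightarrow>
     (\<forall>c < ncr D. arr c \<in> (if positive D c then {East, West} else {North, South}))"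

definition arrow :: "(nat \<Rightarrow> compass) \<Rightarrow> nat set \<Rightarrow> nat \<Rightarrow> compass" where
  "arrow arr \<alpha> c = (if c \<in> \<alpha> then clockwise (arr c) else arr c)"

text \<open>A corner of the crossing lying on the arc.\<close>

fun corner :: "braid \<Rightarrow> nat \<Rightarrow> compass \<Rightarrow> point" where
  "corner D c West = (strand D c, c)"
| "corner D c South = (strand D c, c)"
| "corner D c East = (strand D c + 1, c)"
| "corner D c North = (strand D c, c + 1)"

definition arc_circle :: "braid \<Rightarrow> nat set \<Rightarrow> nat \<Rightarrow> compass \<Rightarrow> point" where
  "arc_circle D \<alpha> c side = circle_of D \<alpha> (corner D c side)"

definition tail_circle :: "braid \<Rightarrow> (nat \<Rightarrow> compass) \<Rightarrow> nat set \<Rightarrow> nat \<Rightarrow> point" where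
  "tail_circle D arr \<alpha> c = arc_circle D \<alpha> c (opposite (arrow arr \<alpha> c))"

definition head_circle :: "braid \<Rightarrow> (nat \<Rightarrow> compass) \<Rightarrow> nat set \<Rightarrow> nat \<Rightarrow> point" where
  "head_circle D arr \<alpha> c = arc_circle D \<alpha> c (arrow arr \<alpha> c)"


section \<open>The maps of the cube\<close>

text \<open>The map for the edge from \<open>\<alpha>\<close> to \<open>insert x \<alpha>\<close>, where \<open>x\<close> is a crossing not in \<open>\<alpha>\<close>. Circles
  are named by points, so in the case of a merge \<open>circle_of\<close> at the target sends each circle to the
  one that it becomes. In the case of a split, all circles but the one that splits keep their
  names.\<close>

definition edge_map :: "braid \<Rightarrow> (nat \<Rightarrow> compass) \<Rightarrow> nat set \<Rightarrow> nat \<Rightarrow>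
    (point, 'r::comm_ring_1) ext \<Rightarrow> (point, 'r) ext" where
  "edge_map D arr \<alpha> x \<omega> =
    (let \<alpha>' = insert x \<alpha>; a = tail_circle D arr \<alpha> x in
     if a \<noteq> head_circle D arr \<alpha> x then ext_map (circles D \<alpha>) (circle_of D \<alpha>') \<omega>
     else
       let v0 = tail_circle D arr \<alpha>' x; v1 = head_circle D arr \<alpha>' x in
       wedge (\<lambda>S. gen v0 S - gen v1 S)
         (ext_map (circles D \<alpha>) (\<lambda>c. if c = a then v0 else c) \<omega>))"

text \<open>The composition along the face spanned by \<open>x\<close> and \<open>y\<close> at \<open>\<alpha>\<close>, first \<open>x\<close>, then \<open>y\<close>, over the
  integers.\<close>

definition face_map :: "braid \<Rightarrow> (nat \<Rightarrow> compass) \<Rightarrow> nat set \<Rightarrow> nat \<Rightarrow> nat \<Rightarrow>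
    (point, int) ext \<Rightarrow> (point, int) ext" where
  "face_map D arr \<alpha> x y \<omega> = edge_map D arr (insert x \<alpha>) y (edge_map D arr \<alpha> x \<omega>)"

definition face_nonzero :: "braid \<Rightarrow> (nat \<Rightarrow> compass) \<Rightarrow> nat set \<Rightarrow> nat \<Rightarrow> nat \<Rightarrow> bool" where
  "face_nonzero D arr \<alpha> x y \<longleftrightarrow>
     (\<exists>\<omega>\<in>ext_algebra (circles D \<alpha>). face_map D arr \<alpha> x y \<omega> \<noteq> (\<lambda>_. 0))"

definition type_A :: "braid \<Rightarrow> (nat \<Rightarrow> compass) \<Rightarrow> nat set \<Rightarrow> nat \<Rightarrow> nat \<Rightarrow> bool" where
  "type_A D arr \<alpha> x y \<longleftrightarrow> face_nonzero D arr \<alpha> x y \<and> face_nonzero D arr \<alpha> y x \<and>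
     (\<forall>\<omega>\<in>ext_algebra (circles D \<alpha>). face_map D arr \<alpha> x y \<omega> = (\<lambda>S. - face_map D arr \<alpha> y x \<omega> S))"

definition type_C :: "braid \<Rightarrow> (nat \<Rightarrow> compass) \<Rightarrow> nat set \<Rightarrow> nat \<Rightarrow> nat \<Rightarrow> bool" where
  "type_C D arr \<alpha> x y \<longleftrightarrow> face_nonzero D arr \<alpha> x y \<and> face_nonzero D arr \<alpha> y x \<and>
     (\<forall>\<omega>\<in>ext_algebra (circles D \<alpha>). face_map D arr \<alpha> x y \<omega> = face_map D arr \<alpha> y x \<omega>)"

text \<open>The arc, if any, that the next step of the walk runs along, with its crossing.\<close>

fun arc_ahead :: "braid \<Rightarrow> nat set \<Rightarrow> point \<times> heading \<Rightarrow> (nat \<times> compass) option" where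
  "arc_ahead D \<alpha> ((k, j), Up) =
     (if j < ncr D \<and> (k = strand D j \<or> k = strand D j + 1)
      then Some (j, if vertical D \<alpha> j then (if k = strand D j then West else East) else South)
      else None)"
| "arc_ahead D \<alpha> ((k, j), Down) =
     (if 0 < j \<and> (k = strand D (j - 1) \<or> k = strand D (j - 1) + 1)
      then Some (j - 1,
        if vertical D \<alpha> (j - 1) then (if k = strand D (j - 1) then West else East) else North)
      else None)"

text \<open>How to leave the tail of an arrow of direction \<open>d\<close> at \<open>c\<close> with the arrow on the left.\<close>

fun leave_tail :: "braid \<Rightarrow> nat \<Rightarrow> compass \<Rightarrow> point \<times> heading" where
  "leave_tail D c East = ((strand D c, c), Down)"
| "leave_tail D c West = ((strand D c + 1, c + 1), Up)"
| "leave_tail D c North = ((strand D c + 1, c), Down)"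
| "leave_tail D c South = ((strand D c, c + 1), Up)"

text \<open>The arc \<open>s\<close> of \<open>y\<close> carries the first endpoint of the arrows at \<open>x\<close> and \<open>y\<close> that is met when
  walking from the tail of the arrow at \<open>x\<close> with this arrow on the left.

  If the arrow at \<open>x\<close> is inside the circle, this walk is counterclockwise. If it is outside, the walk
  is clockwise, but the type of the face read off below is the same: if the four endpoints are, in
  counterclockwise order, inner tail, outer tail, inner head, outer head, then the
  clockwise walk from the outer tail first meets the inner tail, and if they are inner tail, outer
  head, inner head, outer tail, it first meets the inner head. Hence there is no need to determine
  which of the two arrows is the inner one.\<close>

definition next_endpoint ::
    "braid \<Rightarrow> (nat \<Rightarrow> compass) \<Rightarrow> nat set \<Rightarrow> nat \<Rightarrow> nat \<Rightarrow> compass \<Rightarrow> bool" where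
  "next_endpoint D arr \<alpha> x y s \<longleftrightarrow>
    (let st = (\<lambda>m. (walk D \<alpha> ^^ m) (leave_tail D x (arrow arr \<alpha> x))) in
     \<exists>m. arc_ahead D \<alpha> (st m) = Some (y, s) \<and>
       (\<forall>m' < m. \<forall>c s'. arc_ahead D \<alpha> (st m') = Some (c, s') \<longrightarrow> c \<noteq> x \<and> c \<noteq> y))"

definition type_X :: "braid \<Rightarrow> (nat \<Rightarrow> compass) \<Rightarrow> nat set \<Rightarrow> nat \<Rightarrow> nat \<Rightarrow> bool" where
  "type_X D arr \<alpha> x y \<longleftrightarrow> \<not> type_A D arr \<alpha> x y \<and> \<not> type_C D arr \<alpha> x y \<and>
     next_endpoint D arr \<alpha> x y (opposite (arrow arr \<alpha> y))"

definition type_Y :: "braid \<Rightarrow> (nat \<Rightarrow> compass) \<Rightarrow> nat set \<Rightarrow> nat \<Rightarrow> nat \<Rightarrow> bool" where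
  "type_Y D arr \<alpha> x y \<longleftrightarrow> \<not> type_A D arr \<alpha> x y \<and> \<not> type_C D arr \<alpha> x y \<and>
     next_endpoint D arr \<alpha> x y (arrow arr \<alpha> y)"

text \<open>\<open>\<epsilon> (\<alpha>, x)\<close> is the sign of the edge from \<open>\<alpha>\<close> to \<open>insert x \<alpha>\<close>.\<close>

definition face_edges :: "nat set \<Rightarrow> nat \<Rightarrow> nat \<Rightarrow> (nat set \<times> nat) set" where
  "face_edges \<alpha> x y = {(\<alpha>, x), (\<alpha>, y), (insert x \<alpha>, y), (insert y \<alpha>, x)}"

definition sign_assignment ::
    "braid \<Rightarrow> (nat \<Rightarrow> compass) \<Rightarrow> (nat set \<times> nat \<Rightarrow> int) \<Rightarrow> bool" where
  "sign_assignment D arr \<epsilon> \<longleftrightarrow>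
    (\<forall>\<alpha> x. \<alpha> \<subseteq> {..<ncr D} \<and> x < ncr D \<and> x \<notin> \<alpha> \<longrightarrow> \<epsilon> (\<alpha>, x) \<in> {1, - 1}) \<and>
    (\<forall>\<alpha> x y. \<alpha> \<subseteq> {..<ncr D} \<and> x < ncr D \<and> y < ncr D \<and> x \<notin> \<alpha> \<and> y \<notin> \<alpha> \<and> x \<noteq> y \<longrightarrow>
      (type_A D arr \<alpha> x y \<or> type_X D arr \<alpha> x y \<longrightarrow>
         even (card {e \<in> face_edges \<alpha> x y. \<epsilon> e = - 1})) \<and>
      (type_C D arr \<alpha> x y \<or> type_Y D arr \<alpha> x y \<longrightarrow>
         odd (card {e \<in> face_edges \<alpha> x y. \<epsilon> e = - 1})))"


section \<open>The odd Khovanov complex and its homology\<close>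

type_synonym 'r chain = "nat set \<Rightarrow> (point, 'r) ext"

definition chains :: "braid \<Rightarrow> 'r::comm_ring_1 chain set" where
  "chains D = {f. \<forall>\<alpha>. f \<alpha> \<in> ext_algebra (circles D \<alpha>) \<and>
     (\<not> \<alpha> \<subseteq> {..<ncr D} \<longrightarrow> f \<alpha> = (\<lambda>_. 0))}"

definition differential :: "braid \<Rightarrow> (nat \<Rightarrow> compass) \<Rightarrow> (nat set \<times> nat \<Rightarrow> int) \<Rightarrow>
    'r::comm_ring_1 chain \<Rightarrow> 'r chain" where
  "differential D arr \<epsilon> f = (\<lambda>\<alpha>' S. \<Sum>x \<in> \<alpha>' \<inter> {..<ncr D}.
     of_int (\<epsilon> (\<alpha>' - {x}, x)) * edge_map D arr (\<alpha>' - {x}) x (f (\<alpha>' - {x})) S)"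

definition cycle_group :: "braid \<Rightarrow> (nat \<Rightarrow> compass) \<Rightarrow> (nat set \<times> nat \<Rightarrow> int) \<Rightarrow>
    'r::comm_ring_1 chain monoid" where
  "cycle_group D arr \<epsilon> =
    \<lparr>carrier = {f \<in> chains D. differential D arr \<epsilon> f = (\<lambda>_ _. 0)},
     monoid.mult = (\<lambda>f g \<alpha> S. f \<alpha> S + g \<alpha> S), one = (\<lambda>_ _. 0)\<rparr>"

definition boundaries :: "braid \<Rightarrow> (nat \<Rightarrow> compass) \<Rightarrow> (nat set \<times> nat \<Rightarrow> int) \<Rightarrow>
    'r::comm_ring_1 chain set" where
  "boundaries D arr \<epsilon> = differential D arr \<epsilon> ` chains D"

text \<open>The homology as an abelian group (written multiplicatively, so that its zero is \<open>\<one>\<close>).\<close>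

definition Kh :: "braid \<Rightarrow> (nat \<Rightarrow> compass) \<Rightarrow> (nat set \<times> nat \<Rightarrow> int) \<Rightarrow>
    'r::comm_ring_1 chain set monoid" where
  "Kh D arr \<epsilon> = cycle_group D arr \<epsilon> Mod boundaries D arr \<epsilon>"


section \<open>The transverse class\<close>

definition psi_state :: "braid \<Rightarrow> nat set" where
  "psi_state D = {c. c < ncr D \<and> \<not> positive D c}"

definition psi_chain :: "braid \<Rightarrow> 'r::comm_ring_1 chain" where
  "psi_chain D = (\<lambda>\<alpha>. if \<alpha> = psi_state D
     then wedge_gens (map (\<lambda>k. circle_of D (psi_state D) (k, 0)) [1..<fst D + 1])
     else (\<lambda>_. 0))"

definition psi_class :: "braid \<Rightarrow> (nat \<Rightarrow> compass) \<Rightarrow> (nat set \<times> nat \<Rightarrow> int) \<Rightarrow>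
    'r::comm_ring_1 chain set" where
  "psi_class D arr \<epsilon> = boundaries D arr \<epsilon> #>\<^bsub>cycle_group D arr \<epsilon>\<^esub> psi_chain D"

text \<open>The homology of a transverse link \<open>L\<close> and its class \<open>\<psi>(L)\<close> are only given up to isomorphism and
  sign. An abelian group \<open>K\<close> with an element \<open>z\<close> is (a model of) this pair if it is isomorphic to
  the homology of every braid diagram of \<open>L\<close>, computed with suitable choices, in such a way that \<open>z\<close>
  corresponds to the class of \<open>\<psi>\<close> of the diagram up to sign. As the complex of a diagram is
  independent of the choices up to isomorphism, it does not matter which ones are made. The
  isomorphisms are merely required to be additive.\<close>

definition is_psi_of_link ::
    "'r::comm_ring_1 itself \<Rightarrow> braid set \<Rightarrow> 'k monoid \<Rightarrow> 'k \<Rightarrow> bool" where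
  "is_psi_of_link _ L K z \<longleftrightarrow> comm_group K \<and> z \<in> carrier K \<and>
    (\<forall>D\<in>L. \<exists>arr \<epsilon>. arrow_choice D arr \<and> sign_assignment D arr \<epsilon> \<and>
      (\<exists>\<phi> \<in> iso (Kh D arr \<epsilon> :: 'r chain set monoid) K.
         \<phi> (psi_class D arr \<epsilon>) \<in> {z, inv\<^bsub>K\<^esub> z}))"

end

(* With all other crossings smoothed along the orientation, changing the added negative crossing back
   to its 0-smoothing merges the two outermost circles of the resolution carrying psi. Let omega be
   the product of all circles of the resolution so obtained. The map of the edge at the added crossing
   is a split and sends omega to psi up to sign. Every other edge leaving that resolution belongs to a
   positive crossing of the original braid and merges two distinct circles, so it kills omega. Hence
   psi is, up to sign, the boundary of omega. *)

theory Submission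
  imports Defs
begin

section \<open>Products of generators\<close>

text \<open>For finite \<open>A\<close> this is the product of the elements of \<open>A\<close> in
  increasing order; with \<open>A\<close> the set of circles of a resolution it is the product of
  all its circles.\<close>

definition basis_elem :: "'g set \<Rightarrow> ('g, 'r::comm_ring_1) ext" where
  "basis_elem A = (\<lambda>S. if S = A then 1 else 0)"

text \<open>Only the subset \<open>{g}\<close> contributes to the sum, and its inversions are the
  elements of \<open>S\<close> below \<open>g\<close>. Finiteness enters because a sum over the
  infinite set \<open>Pow S\<close> is 0 by convention.\<close>

lemma wedge_gen:
  fixes \<eta> :: "('g::linorder, 'r::comm_ring_1) ext"
  shows "wedge (gen g) \<eta> S =
    (if finite S \<and> g \<in> S then (- 1) ^ card {u \<in> S. u < g} * \<eta> (S - {g}) else 0)"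
proof (cases "finite S")
  case True
  have eq: "{(t, u). t \<in> {g} \<and> u \<in> S - {g} \<and> u < t} = Pair g ` {u \<in> S. u < g}"
    by auto
  have card_eq: "card {(t, u). t \<in> {g} \<and> u \<in> S - {g} \<and> u < t} = card {u \<in> S. u < g}"
    unfolding eq by (rule card_image) (simp add: inj_on_def)
  have "wedge (gen g) \<eta> S = (\<Sum>T\<in>Pow S. if T = {g}
      then (- 1) ^ card {(t, u). t \<in> {g} \<and> u \<in> S - {g} \<and> u < t} * \<eta> (S - {g}) else 0)"
    unfolding wedge_def by (intro sum.cong) (auto simp: gen_def)
  also have "\<dots> = (if {g} \<in> Pow S
      then (- 1) ^ card {(t, u). t \<in> {g} \<and> u \<in> S - {g} \<and> u < t} * \<eta> (S - {g}) else 0)"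
    using True by (subst sum.delta) auto
  finally show ?thesis
    using True by (simp only: card_eq) auto
qed (simp add: wedge_def)

lemma wedge_diff_left:
  "wedge (\<lambda>S. \<omega> S - \<omega>' S) \<eta> S = wedge \<omega> \<eta> S - wedge \<omega>' \<eta> S"
  by (simp add: wedge_def algebra_simps sum_subtractf)

text \<open>Here and up to \<open>boundaries_linear\<close>, linearity is phrased with two
  coefficients, so that zero, sums, differences and multiples are all instances.\<close>

lemma wedge_linear_right:
  "wedge \<omega> (\<lambda>S. r * \<eta> S + s * \<eta>' S) = (\<lambda>S. r * wedge \<omega> \<eta> S + s * wedge \<omega> \<eta>' S)"
  by (simp add: wedge_def algebra_simps sum.distrib sum_distrib_left)

text \<open>By \<open>wedge_gen\<close> each factor removes itself from the index set, so a repeated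
  generator finds nothing left to remove. This is what makes merges kill products.\<close>

lemma wedge_gens_nonzero:
  assumes "(wedge_gens gs :: ('g::linorder, 'r::comm_ring_1) ext) S \<noteq> 0"
  shows "distinct gs \<and> S = set gs"
  using assms
proof (induction gs arbitrary: S)
  case Nil
  then show ?case by (simp add: wedge_gens_def ext_one_def split: if_splits)
next
  case (Cons g gs)
  then have "g \<in> S" "(wedge_gens gs :: ('g, 'r) ext) (S - {g}) \<noteq> 0"
    by (auto simp: wedge_gens_def wedge_gen split: if_splits)
  with Cons.IH[of "S - {g}"] show ?case by auto
qed

lemma wedge_gen_basis_elem:
  fixes A :: "'g::linorder set"
  assumes "finite A" "g \<notin> A"
  shows "wedge (gen g) (basis_elem A) =
    (\<lambda>S. (- 1) ^ card {u \<in> A. u < g} * basis_elem (insert g A) S)"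
proof -
  have "S = insert g A" if "g \<in> S" "S - {g} = A" for S using that by auto
  moreover have "{u \<in> insert g A. u < g} = {u \<in> A. u < g}" by auto
  ultimately show ?thesis
    using assms by (auto simp: wedge_gen basis_elem_def fun_eq_iff)
qed

lemma wedge_gen_basis_elem_zero:
  assumes "g \<in> A"
  shows "wedge (gen g) (basis_elem A) = (\<lambda>_. 0)"
  using assms by (auto simp: wedge_gen basis_elem_def fun_eq_iff)

text \<open>Each new factor is smaller than all later ones, so no inversion and hence no sign
  arises.\<close>

lemma wedge_gens_sorted:
  assumes "sorted_wrt (<) gs"
  shows "wedge_gens gs = (basis_elem (set gs) :: ('g::linorder, 'r::comm_ring_1) ext)"
  using assms
proof (induction gs)
  case Nil
  show ?case by (auto simp: wedge_gens_def ext_one_def basis_elem_def)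
next
  case (Cons g gs)
  then have less: "\<And>u. u \<in> set gs \<Longrightarrow> g < u" by simp
  then have none: "{u \<in> set gs. u < g} = {}" and "g \<notin> set gs" by fastforce+
  have "wedge_gens (g # gs) = (wedge (gen g) (wedge_gens gs) :: ('g, 'r) ext)"
    by (simp add: wedge_gens_def)
  also have "\<dots> = wedge (gen g) (basis_elem (set gs))"
    using Cons by simp
  also have "\<dots> = basis_elem (set (g # gs))"
    using \<open>g \<notin> set gs\<close> none
    by (subst wedge_gen_basis_elem) (simp_all add: none del: Collect_empty_eq)
  finally show ?case .
qed

lemma ext_map_basis_elem:
  assumes "finite G"
  shows "ext_map G \<phi> (basis_elem G) = wedge_gens (map \<phi> (sorted_list_of_set G))"
proof
  fix U
  have "ext_map G \<phi> (basis_elem G) U =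
      (\<Sum>S\<in>Pow G. if S = G then wedge_gens (map \<phi> (sorted_list_of_set G)) U else 0)"
    unfolding ext_map_def by (intro sum.cong) (auto simp: basis_elem_def)
  then show "ext_map G \<phi> (basis_elem G) U = wedge_gens (map \<phi> (sorted_list_of_set G)) U"
    using assms by (subst (asm) sum.delta) auto
qed

text \<open>Two generators with the same image give a repeated factor.\<close>

lemma ext_map_basis_elem_not_inj:
  assumes "finite G" "\<not> inj_on \<phi> G"
  shows "ext_map G \<phi> (basis_elem G) = (\<lambda>_. 0)"
proof -
  have "\<not> distinct (map \<phi> (sorted_list_of_set G))"
    using assms by (simp add: distinct_map)
  then show ?thesis
    unfolding ext_map_basis_elem[OF assms(1)] using wedge_gens_nonzero by fast
qed

lemma ext_map_linear:
  "ext_map G \<phi> (\<lambda>S. r * \<omega> S + s * \<eta> S) =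
    (\<lambda>U. r * ext_map G \<phi> \<omega> U + s * ext_map G \<phi> \<eta> U)"
  by (simp add: ext_map_def algebra_simps sum.distrib sum_distrib_left)


section \<open>Linearity of the differential\<close>

lemma edge_map_linear:
  "edge_map D arr \<alpha> x (\<lambda>S. r * \<omega> S + s * \<eta> S) =
    (\<lambda>S. r * edge_map D arr \<alpha> x \<omega> S + s * edge_map D arr \<alpha> x \<eta> S)"
  by (simp add: edge_map_def Let_def ext_map_linear wedge_linear_right)

lemma edge_map_zero: "edge_map D arr \<alpha> x (\<lambda>_. 0) = (\<lambda>_. 0)"
  using edge_map_linear[of D arr \<alpha> x 0 "\<lambda>_. 0" 0 "\<lambda>_. 0"] by simp

lemma differential_linear:
  "differential D arr \<epsilon> (\<lambda>\<alpha> S. r * f \<alpha> S + s * g \<alpha> S) =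
    (\<lambda>\<alpha> S. r * differential D arr \<epsilon> f \<alpha> S + s * differential D arr \<epsilon> g \<alpha> S)"
  by (simp add: differential_def edge_map_linear algebra_simps sum.distrib sum_distrib_left)

lemma chains_linear:
  assumes "f \<in> chains D" "g \<in> chains D"
  shows "(\<lambda>\<alpha> S. r * f \<alpha> S + s * g \<alpha> S) \<in> chains D"
proof -
  have "S \<subseteq> circles D \<alpha>" if "r * f \<alpha> S + s * g \<alpha> S \<noteq> 0" for \<alpha> S
  proof -
    have "f \<alpha> S \<noteq> 0 \<longrightarrow> S \<subseteq> circles D \<alpha>" "g \<alpha> S \<noteq> 0 \<longrightarrow> S \<subseteq> circles D \<alpha>"
      using assms by (simp_all add: chains_def ext_algebra_def)
    then show ?thesis using that by fastforce
  qed
  moreover have "r * f \<alpha> S + s * g \<alpha> S = 0" if "\<not> \<alpha> \<subseteq> {..<ncr D}" for \<alpha> S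
    using that assms by (simp add: chains_def)
  ultimately show ?thesis by (simp add: chains_def ext_algebra_def)
qed

lemma boundaries_linear:
  assumes "f \<in> boundaries D arr \<epsilon>" "g \<in> boundaries D arr \<epsilon>"
  shows "(\<lambda>\<alpha> S. r * f \<alpha> S + s * g \<alpha> S) \<in> boundaries D arr \<epsilon>"
proof -
  obtain f' g' where "f' \<in> chains D" "g' \<in> chains D"
    "f = differential D arr \<epsilon> f'" "g = differential D arr \<epsilon> g'"
    using assms unfolding boundaries_def by blast
  then show ?thesis
    unfolding boundaries_def
    by (intro image_eqI[where x = "\<lambda>\<alpha> S. r * f' \<alpha> S + s * g' \<alpha> S"])
      (simp_all add: differential_linear chains_linear)
qed

lemma zero_in_chains: "(\<lambda>_ _. 0) \<in> chains D"
  by (simp add: chains_def ext_algebra_def)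

lemma differential_zero: "differential D arr \<epsilon> (\<lambda>_ _. 0) = (\<lambda>_ _. 0)"
  by (simp add: differential_def edge_map_zero)

lemma zero_in_boundaries: "(\<lambda>_ _. 0) \<in> boundaries D arr \<epsilon>"
  unfolding boundaries_def
  by (rule image_eqI[where x = "\<lambda>_ _. 0"]) (simp_all add: differential_zero zero_in_chains)

text \<open>Only edges leaving \<alpha> contribute. The index set has at most one element; writing
  the value as a sum covers the case that \<beta> is not a neighbour of \<alpha>.\<close>

lemma differential_single:
  assumes "\<And>\<alpha>'. \<alpha>' \<noteq> \<alpha> \<Longrightarrow> f \<alpha>' = (\<lambda>_. 0)"
  shows "differential D arr \<epsilon> f \<beta> S = (\<Sum>x \<in> {x. x < ncr D \<and> x \<notin> \<alpha> \<and> \<beta> = insert x \<alpha>}.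
    of_int (\<epsilon> (\<alpha>, x)) * edge_map D arr \<alpha> x (f \<alpha>) S)"
  unfolding differential_def
proof (rule sum.mono_neutral_cong_right)
  show "\<forall>x\<in>\<beta> \<inter> {..<ncr D} - {x. x < ncr D \<and> x \<notin> \<alpha> \<and> \<beta> = insert x \<alpha>}.
      of_int (\<epsilon> (\<beta> - {x}, x)) * edge_map D arr (\<beta> - {x}) x (f (\<beta> - {x})) S = 0"
  proof
    fix x assume x: "x \<in> \<beta> \<inter> {..<ncr D} - {x. x < ncr D \<and> x \<notin> \<alpha> \<and> \<beta> = insert x \<alpha>}"
    then have "\<beta> - {x} \<noteq> \<alpha>" by auto
    then show "of_int (\<epsilon> (\<beta> - {x}, x)) * edge_map D arr (\<beta> - {x}) x (f (\<beta> - {x})) S = 0"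
      using assms by (simp add: edge_map_zero)
  qed
qed auto


section \<open>The class of a boundary\<close>

lemma one_Kh: "\<one>\<^bsub>Kh D arr \<epsilon>\<^esub> = boundaries D arr \<epsilon>"
  by (simp add: Kh_def FactGroup_def)

lemma one_Kh_in_carrier: "\<one>\<^bsub>Kh D arr \<epsilon>\<^esub> \<in> carrier (Kh D arr \<epsilon>)"
proof -
  have "boundaries D arr \<epsilon> #>\<^bsub>cycle_group D arr \<epsilon>\<^esub> (\<lambda>_ _. 0) = boundaries D arr \<epsilon>"
    by (auto simp: r_coset_def cycle_group_def)
  moreover have "(\<lambda>_ _. 0) \<in> carrier (cycle_group D arr \<epsilon>)"
    by (simp add: cycle_group_def zero_in_chains differential_zero)
  ultimately show ?thesis
    unfolding one_Kh by (auto simp: Kh_def FactGroup_def RCOSETS_def)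
qed

text \<open>Boundaries are closed under addition and contain 0. Idempotence is the form used in the
  end: a homomorphism into a group sends an idempotent to the identity.\<close>

lemma one_Kh_idem:
  "\<one>\<^bsub>Kh D arr \<epsilon>\<^esub> \<otimes>\<^bsub>Kh D arr \<epsilon>\<^esub> \<one>\<^bsub>Kh D arr \<epsilon>\<^esub> =
    (\<one>\<^bsub>Kh D arr \<epsilon>\<^esub> :: 'r::comm_ring_1 chain set)"
proof -
  have "boundaries D arr \<epsilon> <#>\<^bsub>cycle_group D arr \<epsilon>\<^esub> boundaries D arr \<epsilon> =
      (boundaries D arr \<epsilon> :: 'r chain set)"
  proof
    show "boundaries D arr \<epsilon> <#>\<^bsub>cycle_group D arr \<epsilon>\<^esub> boundaries D arr \<epsilon> \<subseteq>
        (boundaries D arr \<epsilon> :: 'r chain set)"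
      using boundaries_linear[where r = 1 and s = 1 and D = D and 'a = 'r]
      by (auto simp: set_mult_def cycle_group_def)
    show "(boundaries D arr \<epsilon> :: 'r chain set) \<subseteq>
        boundaries D arr \<epsilon> <#>\<^bsub>cycle_group D arr \<epsilon>\<^esub> boundaries D arr \<epsilon>"
    proof
      fix f :: "'r chain" assume "f \<in> boundaries D arr \<epsilon>"
      then show "f \<in> boundaries D arr \<epsilon> <#>\<^bsub>cycle_group D arr \<epsilon>\<^esub> boundaries D arr \<epsilon>"
        using zero_in_boundaries[of D arr \<epsilon>] by (force simp: set_mult_def cycle_group_def)
    qed
  qed
  then show ?thesis
    unfolding one_Kh by (simp add: Kh_def FactGroup_def)
qed

text \<open>Translating the boundaries by a boundary does not change them: any boundary
  \<open>f\<close> is \<open>(f - psi) + psi\<close>, and \<open>f - psi\<close> is again a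
  boundary.\<close>

lemma psi_class_eq_one:
  assumes "(psi_chain D :: 'r::comm_ring_1 chain) \<in> boundaries D arr \<epsilon>"
  shows "psi_class D arr \<epsilon> = (\<one>\<^bsub>Kh D arr \<epsilon>\<^esub> :: 'r chain set)"
  unfolding one_Kh
proof
  show "psi_class D arr \<epsilon> \<subseteq> (boundaries D arr \<epsilon> :: 'r chain set)"
    using assms boundaries_linear[where r = 1 and s = 1 and D = D and 'a = 'r]
    by (auto simp: psi_class_def r_coset_def cycle_group_def)
  show "(boundaries D arr \<epsilon> :: 'r chain set) \<subseteq> psi_class D arr \<epsilon>"
  proof
    fix f :: "'r chain" assume "f \<in> boundaries D arr \<epsilon>"
    then have "(\<lambda>\<alpha> S. f \<alpha> S - psi_chain D \<alpha> S) \<in> boundaries D arr \<epsilon>"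
      using boundaries_linear[OF _ assms, where r = 1 and s = "- 1"] by fastforce
    then show "f \<in> psi_class D arr \<epsilon>"
      by (force simp: psi_class_def r_coset_def cycle_group_def)
  qed
qed


section \<open>Circles of resolutions of a braid closure\<close>

lemma joinedI:
  assumes "walk D \<alpha> (p, h) = (q, h')" "p \<in> points D" "q \<in> points D"
  shows "joined D \<alpha> p q"
  using assms unfolding joined_def by blast

text \<open>A walk changes its position only at a horizontally smoothed crossing, between the two
  positions there. Labels \<open>f\<close> that agree on these positions are therefore invariants of
  circles and serve to tell circles apart.\<close>

lemma joined_label:
  assumes "joined D \<alpha> p q"
    and "\<And>c. c < ncr D \<Longrightarrow> \<not> vertical D \<alpha> c \<Longrightarrow> f (strand D c) = f (strand D c + 1)"
  shows "f (fst p) = f (fst q)"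
proof -
  obtain k j h h' where p: "p = (k, j)" and jn: "j \<le> ncr D" and w: "walk D \<alpha> ((k, j), h) = (q, h')"
    using assms(1) by (cases p) (auto simp: joined_def points_def)
  show ?thesis
  proof (cases h)
    case Up
    then show ?thesis using w p jn assms(2)[of j] by (auto split: if_splits)
  next
    case Down
    then show ?thesis using w p jn assms(2)[of "j - 1"] by (auto split: if_splits)
  qed
qed

lemma equivclp_joined_label:
  assumes "equivclp (joined D \<alpha>) p q"
    and "\<And>c. c < ncr D \<Longrightarrow> \<not> vertical D \<alpha> c \<Longrightarrow> f (strand D c) = f (strand D c + 1)"
  shows "f (fst p) = f (fst q)"
  using assms(1)
proof (induction rule: equivclp_induct)
  case (step y z)
  then show ?case using joined_label[OF _ assms(2)] by metis
qed simp

lemma equivclp_joined_up: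
  assumes "k \<in> {1..fst D}" "j \<le> ncr D" "\<And>c. c < j \<Longrightarrow> vertical D \<alpha> c"
  shows "equivclp (joined D \<alpha>) (k, 0) (k, j)"
  using assms(2,3)
proof (induction j)
  case (Suc j)
  have "walk D \<alpha> ((k, j), Up) = ((k, Suc j), Up)" using Suc.prems by simp
  then have "joined D \<alpha> (k, j) (k, Suc j)"
    by (rule joinedI) (use assms(1) Suc.prems(1) in \<open>auto simp: points_def\<close>)
  then show ?case using Suc by (auto intro: equivclp_into_equivclp)
qed simp

lemma joined_horizontal:
  assumes "c < ncr D" "\<not> vertical D \<alpha> c" "1 \<le> strand D c" "strand D c < fst D"
  shows "joined D \<alpha> (strand D c, c) (strand D c + 1, c)"
proof -
  have "walk D \<alpha> ((strand D c, c), Up) = ((strand D c + 1, c), Down)" using assms by simp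
  then show ?thesis by (rule joinedI) (use assms in \<open>auto simp: points_def\<close>)
qed

text \<open>The path goes up one strand, across the southern arc and down the other strand. It meets
  only crossings up to \<open>c\<close>, so the lemma also applies when a later crossing is
  horizontal.\<close>

lemma equivclp_joined_horizontal:
  assumes "c < ncr D" "\<not> vertical D \<alpha> c" "1 \<le> strand D c" "strand D c < fst D"
    and "\<And>c'. c' < c \<Longrightarrow> vertical D \<alpha> c'"
  shows "equivclp (joined D \<alpha>) (strand D c, 0) (strand D c + 1, 0)"
proof -
  have "equivclp (joined D \<alpha>) (strand D c, 0) (strand D c, c)"
    using assms by (intro equivclp_joined_up) auto
  moreover have "equivclp (joined D \<alpha>) (strand D c, c) (strand D c + 1, c)"
    using joined_horizontal assms(1-4) by (intro r_into_equivclp) auto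
  moreover have "equivclp (joined D \<alpha>) (strand D c + 1, c) (strand D c + 1, 0)"
    using assms by (intro equivclp_sym[OF equivclp_joined_up]) auto
  ultimately show ?thesis by (meson equivclp_trans)
qed

lemma circle_of_cong:
  assumes "equivclp (joined D \<alpha>) p q"
  shows "circle_of D \<alpha> p = circle_of D \<alpha> q"
proof -
  have "equivclp (joined D \<alpha>) p r \<longleftrightarrow> equivclp (joined D \<alpha>) q r" for r
    using assms by (meson equivclp_sym equivclp_trans)
  then show ?thesis by (simp add: circle_of_def)
qed

text \<open>Here \<open>f k\<close> is the leftmost position on the circle through position
  \<open>k\<close>: \<open>le\<close> provides a path to it, and \<open>label\<close> prevents the
  circle from reaching a smaller position. The last crossing may be horizontal.\<close>

lemma circle_of_eq:
  assumes vert: "\<And>c. Suc c < ncr D \<Longrightarrow> vertical D \<alpha> c"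
    and label: "\<And>c. c < ncr D \<Longrightarrow> \<not> vertical D \<alpha> c \<Longrightarrow> f (strand D c) = f (strand D c + 1)"
    and le: "\<And>k. k \<in> {1..fst D} \<Longrightarrow> f k \<in> {1..k} \<and> equivclp (joined D \<alpha>) (k, 0) (f k, 0)"
    and pt: "(k, j) \<in> points D"
  shows "circle_of D \<alpha> (k, j) = (f k, 0)"
proof -
  have k: "k \<in> {1..fst D}" and j: "j \<le> ncr D" using pt by (auto simp: points_def)
  have "equivclp (joined D \<alpha>) (k, j) (k, 0)"
  \<comment> \<open>From the top level the closure leads to level 0, avoiding the last crossing;
    from all other levels only vertical crossings lie below.\<close>
  proof (cases "j = ncr D")
    case True
    have "walk D \<alpha> ((k, j), Up) = ((k, 0), Up)" using True by simp
    then have "joined D \<alpha> (k, j) (k, 0)"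
      by (rule joinedI) (use k j in \<open>auto simp: points_def\<close>)
    then show ?thesis by blast
  next
    case False
    then show ?thesis using k j vert by (intro equivclp_sym[OF equivclp_joined_up]) auto
  qed
  then have eqv: "equivclp (joined D \<alpha>) (k, j) (f k, 0)"
    using le[OF k] by (meson equivclp_trans)
  show ?thesis
    unfolding circle_of_def
  proof (rule Min_eqI)
    show "finite {q \<in> points D. equivclp (joined D \<alpha>) (k, j) q}"
      by (simp add: points_def)
    show "(f k, 0) \<in> {q \<in> points D. equivclp (joined D \<alpha>) (k, j) q}"
      using eqv le[OF k] k by (auto simp: points_def)
    fix q assume q: "q \<in> {q \<in> points D. equivclp (joined D \<alpha>) (k, j) q}"
    then have "f k = f (fst q)" using equivclp_joined_label[OF _ label, of \<alpha> "(k, j)" q] by simp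
    moreover have "f (fst q) \<le> fst q" using q le[of "fst q"] by (auto simp: points_def)
    \<comment> \<open>Points are ordered lexicographically with the position first, and level 0 is
      the least.\<close>
    ultimately show "(f k, 0) \<le> q" by (cases q) auto
  qed
qed

lemma circle_of_vertical:
  assumes "\<And>c. c < ncr D \<Longrightarrow> vertical D \<alpha> c" "(k, j) \<in> points D"
  shows "circle_of D \<alpha> (k, j) = (k, 0)"
  using assms by (intro circle_of_eq[where f = "\<lambda>k. k"]) auto

text \<open>The label \<open>min k b\<close> identifies the two rightmost positions \<open>b\<close>
  and \<open>b + 1\<close>, which the last crossing joins, and separates all others.\<close>

lemma circle_of_last_horizontal:
  assumes "ncr D = Suc n" "fst D = Suc b" "strand D n = b" "1 \<le> b"
    and vert: "\<And>c. c < n \<Longrightarrow> vertical D \<alpha> c" and "\<not> vertical D \<alpha> n" "(k, j) \<in> points D"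
  shows "circle_of D \<alpha> (k, j) = (min k b, 0)"
proof (rule circle_of_eq[where f = "\<lambda>k. min k b"])
  have "equivclp (joined D \<alpha>) (b, 0) (b + 1, 0)"
    using equivclp_joined_horizontal[of n D \<alpha>] assms by simp
  then have "equivclp (joined D \<alpha>) (Suc b, 0) (b, 0)" by (auto intro: equivclp_sym)
  then show "min k b \<in> {1..k} \<and> equivclp (joined D \<alpha>) (k, 0) (min k b, 0)"
    if "k \<in> {1..fst D}" for k
    using that assms(2,4) by (cases "k = Suc b") auto
next
  fix c assume "c < ncr D" "\<not> vertical D \<alpha> c"
  then have "c = n" using vert assms(1) by (metis less_SucE)
  then show "min (strand D c) b = min (strand D c + 1) b" using assms(3) by simp
qed (use assms in auto)


section \<open>The transverse class of a negative stabilization\<close>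

text \<open>Distinct tail and head circles select the merge branch of \<open>edge_map\<close>, and
  there \<open>p\<close> and \<open>q\<close> are sent to the same generator.\<close>

lemma edge_map_circles_merge:
  assumes merge: "tail_circle D arr \<alpha> x \<noteq> head_circle D arr \<alpha> x"
    and fin: "finite (circles D \<alpha>)" and "p \<in> circles D \<alpha>" "q \<in> circles D \<alpha>" "p \<noteq> q"
    and "equivclp (joined D (insert x \<alpha>)) p q"
  shows "edge_map D arr \<alpha> x (basis_elem (circles D \<alpha>)) = (\<lambda>_. 0)"
proof -
  have "\<not> inj_on (circle_of D (insert x \<alpha>)) (circles D \<alpha>)"
    using circle_of_cong assms(3-6) by (metis inj_onD)
  then show ?thesis
    using merge fin by (simp add: edge_map_def Let_def ext_map_basis_elem_not_inj)
qed

lemma psi_chain_neg_stab_boundary: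
  fixes D :: braid
  assumes D: "D \<in> braid_words" and arr: "arrow_choice (neg_stab D) arr"
    and \<epsilon>: "sign_assignment (neg_stab D) arr \<epsilon>"
  shows "(psi_chain (neg_stab D) :: 'r::comm_ring_1 chain) \<in> boundaries (neg_stab D) arr \<epsilon>"
proof -
  obtain b w where Dbw: "D = (b, w)" by force
  define E where "E = neg_stab D"
  define n where "n = length w"
  define \<beta> where "\<beta> = psi_state E"
  define \<alpha> where "\<alpha> = \<beta> - {n}"
  \<comment> \<open>These will be the circles at \<alpha>: positions \<open>b\<close> and
    \<open>b + 1\<close> share the name \<open>(b, 0)\<close>.\<close>
  define G :: "point set" where "G = (\<lambda>k. (k, 0)) ` {1..b}"
  have E: "E = (Suc b, w @ [(b, False)])" by (simp add: E_def neg_stab_def Dbw)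
  have ncr: "ncr E = Suc n" and fstE: "fst E = Suc b" and sn: "strand E n = b"
    and nn: "\<not> positive E n"
    by (simp_all add: E n_def)
  have b: "1 \<le> b" using D by (auto simp: braid_words_def Dbw)
  have s: "1 \<le> strand E c \<and> strand E c < b" if "c < n" for c
  proof -
    have "snd E ! c = w ! c" using that by (simp add: E n_def nth_append)
    moreover have "w ! c \<in> set w" using that by (simp add: n_def)
    ultimately show ?thesis using D by (auto simp: braid_words_def Dbw)
  qed
  have n\<beta>: "n \<in> \<beta>" using nn ncr by (simp add: \<beta>_def psi_state_def)
  have ins: "insert n \<alpha> = \<beta>" using n\<beta> by (auto simp: \<alpha>_def)
  have \<alpha>_sub: "\<alpha> \<subseteq> {..<ncr E}" by (auto simp: \<alpha>_def \<beta>_def psi_state_def)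
  have v\<beta>: "vertical E \<beta> c" if "c < ncr E" for c
    using that by (auto simp: vertical_def \<beta>_def psi_state_def)
  have v\<alpha>: "vertical E \<alpha> c" if "c < n" for c
    using that v\<beta>[of c] ncr by (auto simp: vertical_def \<alpha>_def)
  have nv\<alpha>: "\<not> vertical E \<alpha> n" using nn by (simp add: vertical_def \<alpha>_def)
  have c\<beta>: "circle_of E \<beta> (k, j) = (k, 0)" if "(k, j) \<in> points E" for k j
    using circle_of_vertical v\<beta> that by blast
  have c\<alpha>: "circle_of E \<alpha> (k, j) = (min k b, 0)" if "(k, j) \<in> points E" for k j
    using circle_of_last_horizontal[OF ncr fstE sn b v\<alpha> nv\<alpha> that] .
  have pts: "(k, j) \<in> points E \<longleftrightarrow> 1 \<le> k \<and> k \<le> Suc b \<and> j \<le> Suc n" for k j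
    by (auto simp: points_def fstE ncr)
  have circ: "circles E \<alpha> = G"
  proof
    show "circles E \<alpha> \<subseteq> G" using b by (auto simp: circles_def G_def c\<alpha> pts)
    show "G \<subseteq> circles E \<alpha>"
    proof
      fix p assume "p \<in> G"
      then obtain k where "p = (k, 0)" "1 \<le> k" "k \<le> b" by (auto simp: G_def)
      then have "p = circle_of E \<alpha> (k, 0)" "(k, 0) \<in> points E" by (auto simp: c\<alpha> pts)
      then show "p \<in> circles E \<alpha>" by (auto simp: circles_def)
    qed
  qed
  have finG: "finite G" by (simp add: G_def)
  have sorted_G: "sorted_list_of_set G = map (\<lambda>k. (k, 0)) [1..<Suc b]"
  proof (rule sorted_distinct_set_unique[symmetric])
    show "sorted (map (\<lambda>k. (k, 0::nat)) [1..<Suc b])"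
      by (intro strict_sorted_imp_sorted) (simp add: sorted_wrt_map del: upt_Suc)
  qed (auto simp: G_def distinct_map inj_on_def)
  have psi: "psi_chain E \<beta> = (basis_elem (insert (Suc b, 0) G) :: (point, 'r) ext)"
  proof -
    have "map (\<lambda>k. circle_of E \<beta> (k, 0)) [1..<fst E + 1] = map (\<lambda>k. (k, 0)) [1..<Suc (Suc b)]"
      by (auto simp: c\<beta> pts fstE)
    moreover have "set (map (\<lambda>k. (k, 0::nat)) [1..<Suc (Suc b)]) = insert (Suc b, 0) G"
      by (auto simp: G_def)
    moreover have "sorted_wrt (<) (map (\<lambda>k. (k, 0::nat)) [1..<Suc (Suc b)])"
      by (simp add: sorted_wrt_map del: upt_Suc)
    ultimately show ?thesis
      unfolding psi_chain_def \<beta>_def[symmetric] by (simp del: upt_Suc add: wedge_gens_sorted)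
  qed
  have merge: "edge_map E arr \<alpha> x (basis_elem G) = (\<lambda>_. 0 :: 'r)" if x: "x < n" "x \<notin> \<alpha>" for x
  proof -
    \<comment> \<open>Below \<open>n\<close> every crossing is vertical at \<alpha>, so one outside
      \<alpha> must be positive.\<close>
    have pos: "positive E x" using x v\<alpha>[of x] by (auto simp: vertical_def split: if_splits)
    then have "arr x \<in> {East, West}"
      using arr x ncr unfolding arrow_choice_def E_def[symmetric] by (metis less_SucI)
    \<comment> \<open>Crossing \<open>x\<close> comes from the braid on \<open>b\<close> strands, so
      both of its positions are at most \<open>b\<close>, where \<open>min k b\<close> is
      injective.\<close>
    then have "tail_circle E arr \<alpha> x \<noteq> head_circle E arr \<alpha> x"
      using x s[of x]
      by (auto simp: tail_circle_def head_circle_def arc_circle_def arrow_def opposite_def c\<alpha> pts)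
    moreover have "equivclp (joined E (insert x \<alpha>)) (strand E x, 0) (strand E x + 1, 0)"
    proof (rule equivclp_joined_horizontal)
      show "\<not> vertical E (insert x \<alpha>) x" using pos by (simp add: vertical_def)
      show "vertical E (insert x \<alpha>) c" if "c < x" for c
        using v\<alpha>[of c] that x by (auto simp: vertical_def)
    qed (use x s[of x] ncr fstE in auto)
    moreover have "(strand E x, 0) \<in> G" "(strand E x + 1, 0) \<in> G"
      using s[OF x(1)] by (auto simp: G_def)
    ultimately show ?thesis
      using edge_map_circles_merge[of E arr \<alpha> x "(strand E x, 0)" "(strand E x + 1, 0)"] finG
      by (simp add: circ)
  qed
  \<comment> \<open>The exponent depends on the arrow at \<open>n\<close>; it is enough that the
    factor is a power of -1.\<close>
  have "\<exists>m. edge_map E arr \<alpha> n (basis_elem G) = (\<lambda>S. (- 1 :: 'r) ^ m * psi_chain E \<beta> S)"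
  proof -
    have "arr n \<in> {North, South}"
      using arr nn ncr by (auto simp: arrow_choice_def E_def[symmetric])
    \<comment> \<open>Both horizontal arcs at \<open>n\<close> lie on the circle
      \<open>(b, 0)\<close>, so this edge is a split. Turned clockwise, the arrow points east or
      west, hence the two possible orders of \<open>v0\<close> and \<open>v1\<close>.\<close>
    then obtain v0 v1 where tail: "tail_circle E arr \<alpha> n = (b, 0)" "head_circle E arr \<alpha> n = (b, 0)"
      and v: "tail_circle E arr \<beta> n = v0" "head_circle E arr \<beta> n = v1"
      and v01: "(v0, v1) \<in> {((b, 0), (Suc b, 0)), ((Suc b, 0), (b, 0))}"
      using b n\<beta> sn
      by (auto simp: tail_circle_def head_circle_def arc_circle_def arrow_def opposite_def c\<alpha> c\<beta>
          pts \<alpha>_def[THEN eqset_imp_iff])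
    define H :: "point set" where "H = insert v0 (G - {(b, 0)})"
    let ?ren = "\<lambda>c. if c = (b, 0) then v0 else c"
    have ren: "ext_map G ?ren (basis_elem G) = (basis_elem H :: (point, 'r) ext)"
    proof -
      \<comment> \<open>The renamed generator is the last one of \<open>G\<close>, and
        \<open>v0\<close> has position \<open>b\<close> or \<open>b + 1\<close>, so the list stays
        increasing and no sign appears.\<close>
      have "map ?ren (sorted_list_of_set G) = map (\<lambda>k. (k, 0)) [1..<b] @ [v0]"
        using b unfolding sorted_G by auto
      moreover have "sorted_wrt (<) (map (\<lambda>k. (k, 0::nat)) [1..<b] @ [v0])"
        using v01 by (auto simp: sorted_wrt_append sorted_wrt_map)
      moreover have "set (map (\<lambda>k. (k, 0::nat)) [1..<b] @ [v0]) = H"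
        by (auto simp: H_def G_def)
      ultimately show ?thesis
        using finG by (simp only: ext_map_basis_elem wedge_gens_sorted)
    qed
    have "v1 \<notin> H" and H: "insert v1 H = insert (Suc b, 0) G" and "finite H"
      using v01 b finG by (auto simp: H_def G_def)
    have "edge_map E arr \<alpha> n (basis_elem G) =
        wedge (\<lambda>S. gen v0 S - gen v1 S) (basis_elem H :: (point, 'r) ext)"
      by (simp add: edge_map_def Let_def ins tail v circ ren cong: if_cong)
    \<comment> \<open>The factor \<open>v0\<close> already occurs in \<open>basis_elem H\<close>, so
      only the \<open>v1\<close> term survives.\<close>
    also have "\<dots> = (\<lambda>S. - wedge (gen v1) (basis_elem H) S)"
      by (simp add: wedge_diff_left wedge_gen_basis_elem_zero H_def fun_eq_iff)
    also have "\<dots> = (\<lambda>S. (- 1) ^ Suc (card {u \<in> H. u < v1}) * psi_chain E \<beta> S)"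
      using \<open>v1 \<notin> H\<close> \<open>finite H\<close> by (simp add: wedge_gen_basis_elem H psi)
    finally show ?thesis by blast
  qed
  then obtain m where
    split: "edge_map E arr \<alpha> n (basis_elem G) = (\<lambda>S. (- 1 :: 'r) ^ m * psi_chain E \<beta> S)" by blast
  define f :: "'r chain" where "f = (\<lambda>\<alpha>'. if \<alpha>' = \<alpha> then basis_elem G else (\<lambda>_. 0))"
  define t :: 'r where "t = of_int (\<epsilon> (\<alpha>, n)) * (- 1) ^ m"
  have "f \<in> chains E"
    using \<alpha>_sub by (auto simp: chains_def f_def ext_algebra_def basis_elem_def circ)
  have n\<alpha>: "n \<notin> \<alpha>" by (simp add: \<alpha>_def)
  have df: "differential E arr \<epsilon> f = (\<lambda>\<gamma> S. t * psi_chain E \<gamma> S)"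
  proof (intro ext)
    fix \<gamma> S
    have "differential E arr \<epsilon> f \<gamma> S = (\<Sum>x \<in> {x. x < ncr E \<and> x \<notin> \<alpha> \<and> \<gamma> = insert x \<alpha>}.
        of_int (\<epsilon> (\<alpha>, x)) * edge_map E arr \<alpha> x (basis_elem G) S)"
      by (subst differential_single[where \<alpha> = \<alpha>]) (simp_all add: f_def)
    \<comment> \<open>By \<open>merge\<close> the edges at crossings below \<open>n\<close>
      contribute 0; the edge at \<open>n\<close> ends in \<beta>.\<close>
    also have "\<dots> = (\<Sum>x \<in> {x. x = n \<and> \<gamma> = \<beta>}.
        of_int (\<epsilon> (\<alpha>, x)) * edge_map E arr \<alpha> x (basis_elem G) S)"
    proof (rule sum.mono_neutral_right)
      show "\<forall>x\<in>{x. x < ncr E \<and> x \<notin> \<alpha> \<and> \<gamma> = insert x \<alpha>} - {x. x = n \<and> \<gamma> = \<beta>}.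
          of_int (\<epsilon> (\<alpha>, x)) * edge_map E arr \<alpha> x (basis_elem G) S = (0 :: 'r)"
        using ins merge ncr by (auto simp: less_Suc_eq)
    qed (use ins n\<alpha> ncr in auto)
    also have "\<dots> = t * psi_chain E \<gamma> S"
    proof (cases "\<gamma> = \<beta>")
      case True
      then show ?thesis by (simp add: split t_def)
    qed (simp add: psi_chain_def \<beta>_def)
    finally show "differential E arr \<epsilon> f \<gamma> S = t * psi_chain E \<gamma> S" .
  qed
  have "\<forall>\<alpha> x. \<alpha> \<subseteq> {..<ncr E} \<and> x < ncr E \<and> x \<notin> \<alpha> \<longrightarrow> \<epsilon> (\<alpha>, x) \<in> {1, - 1}"
    using \<epsilon> unfolding sign_assignment_def E_def[symmetric] by (rule conjunct1)
  then have "\<epsilon> (\<alpha>, n) \<in> {1, - 1}"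
    using \<alpha>_sub n\<alpha> ncr by simp
  then have "t * t = 1"
    by (auto simp: t_def simp flip: power_add mult_2)
  moreover have "differential E arr \<epsilon> f \<in> boundaries E arr \<epsilon>"
    using \<open>f \<in> chains E\<close> by (simp add: boundaries_def)
  \<comment> \<open>With second coefficient 0 this scales the boundary by \<open>t\<close>, which is
    its own inverse and so cancels the factor of psi.\<close>
  from boundaries_linear[OF this this, of t 0]
  have "(\<lambda>\<gamma> S. t * (t * psi_chain E \<gamma> S)) \<in> boundaries E arr \<epsilon>"
    by (simp add: df)
  ultimately show ?thesis
    by (simp flip: mult.assoc E_def)
qed

section \<open>From the stabilized diagram to the transverse link\<close>

lemma psi_class_neg_stab:
  assumes "D \<in> braid_words" "arrow_choice (neg_stab D) arr" "sign_assignment (neg_stab D) arr \<epsilon>"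
  shows "psi_class (neg_stab D) arr \<epsilon> = \<one>\<^bsub>Kh (neg_stab D) arr \<epsilon>\<^esub>"
  using assms by (intro psi_class_eq_one psi_chain_neg_stab_boundary)

lemma transverse_links_subset_braid_words:
  assumes "L \<in> transverse_links" "D \<in> L"
  shows "D \<in> braid_words"
  using assms by (auto simp: transverse_links_def transverse_rel_def quotient_def)

theorem proposition4p2:
  fixes L L0 :: "braid set" and K :: "'k monoid" and z :: 'k
  assumes "coefficient_ring TYPE('r::comm_ring_1)"
    and "is_neg_stab_of L L0"
  shows "(\<forall>D\<in>L0. neg_stab D \<in> L \<longrightarrow>
           (\<forall>arr \<epsilon>. arrow_choice (neg_stab D) arr \<and> sign_assignment (neg_stab D) arr \<epsilon> \<longrightarrow>
             (psi_class (neg_stab D) arr \<epsilon> :: 'r chain set)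
               = \<one>\<^bsub>Kh (neg_stab D) arr \<epsilon>\<^esub>)) \<and>
         (is_psi_of_link TYPE('r) L K z \<longrightarrow> z = \<one>\<^bsub>K\<^esub>)"
proof (intro conjI ballI impI allI)
  fix D arr \<epsilon>
  assume "D \<in> L0" "arrow_choice (neg_stab D) arr \<and> sign_assignment (neg_stab D) arr \<epsilon>"
  then show "(psi_class (neg_stab D) arr \<epsilon> :: 'r chain set) = \<one>\<^bsub>Kh (neg_stab D) arr \<epsilon>\<^esub>"
    using psi_class_neg_stab transverse_links_subset_braid_words assms(2)
    unfolding is_neg_stab_of_def by blast
next
  assume psi: "is_psi_of_link TYPE('r) L K z"
  then interpret K: comm_group K by (simp add: is_psi_of_link_def)
  obtain D where D: "D \<in> braid_words" "neg_stab D \<in> L"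
    using assms(2) transverse_links_subset_braid_words unfolding is_neg_stab_of_def by blast
  obtain arr \<epsilon> \<phi> where choice: "arrow_choice (neg_stab D) arr" "sign_assignment (neg_stab D) arr \<epsilon>"
    and \<phi>: "\<phi> \<in> iso (Kh (neg_stab D) arr \<epsilon> :: 'r chain set monoid) K"
    and z: "\<phi> (psi_class (neg_stab D) arr \<epsilon>) \<in> {z, inv\<^bsub>K\<^esub> z}" and zK: "z \<in> carrier K"
    using psi D(2) unfolding is_psi_of_link_def by blast
  let ?one = "\<one>\<^bsub>Kh (neg_stab D) arr \<epsilon>\<^esub> :: 'r chain set"
  have hom: "\<phi> \<in> hom (Kh (neg_stab D) arr \<epsilon>) K" using \<phi> by (simp add: iso_def)
  have "\<phi> ?one \<in> carrier K" using hom one_Kh_in_carrier by (rule hom_in_carrier)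
  moreover have "\<phi> ?one \<otimes>\<^bsub>K\<^esub> \<phi> ?one = \<phi> ?one"
    using hom_mult[OF hom one_Kh_in_carrier one_Kh_in_carrier] by (simp add: one_Kh_idem)
  \<comment> \<open>The identity is the only idempotent of the group \<open>K\<close>.\<close>
  ultimately have "\<phi> ?one = \<one>\<^bsub>K\<^esub>" by simp
  moreover have "psi_class (neg_stab D) arr \<epsilon> = ?one"
    using psi_class_neg_stab[OF D(1) choice] .
  \<comment> \<open>Now \<open>z\<close> or its inverse is the identity, so the sign ambiguity is
    harmless.\<close>
  ultimately show "z = \<one>\<^bsub>K\<^esub>"
    using z zK by (metis K.inv_eq_1_iff insert_iff singletonD)
qed

end
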